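(* Let $Q_{2k+2}=\begin{bmatrix}U_k&u_{k+1}&\Pi\overline{U}_k&\Pi\overline{u}_{k+1}\end{bmatrix}\in\mathbb{C}^{2n\times(2k+2)}$ and $Q_{2k}=\begin{bmatrix}U_k&\Pi\overline{U}_k\end{bmatrix}\in\mathbb{C}^{2n\times 2k}$ with $U_k\in\mathbb{C}^{2n\times k}$, $u_{k+1}\in\mathbb{C}^{2n}$, and suppose there is $\Gamma_{2k+2}\in\mathbf{\Gamma}_{2k+2}$ with $Q_{2k+2}^H\Gamma_0Q_{2k+2}=\Gamma_{2k+2}$. Suppose that $$\mathscr{H}Q_{2k}=Q_{2k+2}\widetilde{T}_{2k},$$ where $\widetilde{T}_{2k}$ is of the form $$\widetilde{T}_{2k}=\begin{bmatrix}T_{11}&-\overline{T}_{21}\\ \zeta_{kk}\tau_{k+1}e_k^T&0\\ T_{21}&-\overline{T}_{11}\\0&-\overline{\zeta}_{kk}\overline{\tau}_{k+1}e_k^T\end{bmatrix}\in\mathbb{C}^{(2k+2)\times 2k}$$ with scalars $\zeta_{kk},\tau_{k+1}\in\mathbb{C}$, and where $T_{11}\in\mathbb{C}^{k\times k}$ is unreduced tridiagonal and $T_{21}\in\mathbb{C}^{k\times k}$ is diagonal. Let $q_1\in\mathbb{C}^{2n}$ be the first column of $Q_{2k+2}$ (also the first column of $Q_{2k}$). Then $K_{2k+2}(\mathscr{H},q_1)$ has the $\Gamma$QR factorization $$K_{2k+2}(\mathscr{H},q_1)=Q_{2k+2}R_{2k+2},$$ where $R_{2k+2}\in\mathbb{C}^{(2k+2)\times(2k+2)}$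 is a nonsingular $\Pi^+$-upper triangular matrix. Moreover, $\mathrm{rank}(K_{2k+2}(\mathscr{H},q_1))=2k+2$.
   Context: $\mathscr{H}=\begin{bmatrix}A&B\\-\overline{B}&-\overline{A}\end{bmatrix}\in\mathbb{C}^{2n\times 2n}$, where $A,B\in\mathbb{C}^{n\times n}$ satisfy $A^H=A$, $B^T=B$. $\Pi=\begin{bmatrix}0&I_n\\ I_n&0\end{bmatrix}$, $\Gamma_0=\mathrm{diag}(I_n,-I_n)$, and $\mathbf{\Gamma}_{2m}=\{\mathrm{diag}(J,-J): J$ an $m\times m$ diagonal matrix with diagonal entries $\pm1\}$. $e_k$ is the $k$-th column of the identity. A square matrix $\begin{bmatrix}R_1&\overline{R}_2\\ R_2&\overline{R}_1\end{bmatrix}$ with $R_1,R_2\in\mathbb{C}^{m\times m}$ is $\Pi^+$-upper triangular if $R_1$ is upper triangular and $R_2$ is strictly upper triangular. A (skinny) $\Gamma$QR factorization, with respect to $\Gamma_0$, of a matrix $G\in\mathbb{C}^{2n\times 2m}$ with $G\Pi_{2m}=\Pi\overline{G}$, where $\Pi_{2m}=\begin{bmatrix}0&I_m\\ I_m&0\end{bmatrix}$, is $G=QR$ with $R$ a $2m\times 2m$ $\Pi^+$-upper triangular matrix and $Q\in\mathbb{C}^{2n\times 2m}$ satisfying $Q\Pi_{2m}=\Pi\overline{Q}$ and $Q^H\Gamma_0Q\in\mathbf{\Gamma}_{2m}$. The $(k+1)$-th order $\mathbf{\Pi}$-Krylov matrix is $$K_{2k+2}(\mathscr{H},q_1)=\begin{bmatrix}q_1&\mathscr{H}q_1&\cdots&\mathscr{H}^{k}q_1&\Pi\overline{q}_1&\Pi\overline{\mathscr{H}}\,\overline{q}_1&\cdots&\Pi\overline{\mathscr{H}}^{k}\overline{q}_1\end{bmatrix}.$$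 A tridiagonal matrix is unreduced if all its sub-diagonal entries are nonzero.
   Formalization: The hypothesis that ζ_kk τ_{k+1} is nonzero is added; if it is zero, the columns of Q_{2k} span an invariant subspace, K_{2k+2} has rank at most 2k, and the claim always fails (e.g. n=2, k=1, B=0, A diagonal, U=e_1, u=e_2). *)

theory Defs
  imports
    Complex_Main
    "Jordan_Normal_Form.Schur_Decomposition"
    "Jordan_Normal_Form.DL_Rank"
begin

abbreviation conj_mat :: "complex mat \<Rightarrow> complex mat" where
  "conj_mat \<equiv> map_mat cnj"

abbreviation conj_vec :: "complex vec \<Rightarrow> complex vec" where
  "conj_vec \<equiv> map_vec cnj"

definition bse_mat :: "complex mat \<Rightarrow> complex mat \<Rightarrow> complex mat" where
  "bse_mat A B = four_block_mat A B (- conj_mat B) (- conj_mat A)"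

(* The size parameter of Pi_mat, Gamma0_mat, Gamma_mats and Pi_upper_triangular is the
   block size m, so that these are matrices of order 2m; e.g. Gamma_mats m is the set
   with index 2m in the usual notation. *)

definition Pi_mat :: "nat \<Rightarrow> complex mat" where
  "Pi_mat m = four_block_mat (0\<^sub>m m m) (1\<^sub>m m) (1\<^sub>m m) (0\<^sub>m m m)"

definition Gamma0_mat :: "nat \<Rightarrow> complex mat" where
  "Gamma0_mat m = four_block_mat (1\<^sub>m m) (0\<^sub>m m m) (0\<^sub>m m m) (- 1\<^sub>m m)"

definition Gamma_mats :: "nat \<Rightarrow> complex mat set" where
  "Gamma_mats m =
     {four_block_mat J (0\<^sub>m m m) (0\<^sub>m m m) (- J) | J.
        J \<in> carrier_mat m m \<and> diagonal_mat J \<and> (\<forall>i<m. J $$ (i, i) \<in> {1, -1})}"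

definition strictly_upper_triangular :: "complex mat \<Rightarrow> bool" where
  "strictly_upper_triangular R \<longleftrightarrow> (\<forall>i<dim_row R. \<forall>j<dim_col R. j \<le> i \<longrightarrow> R $$ (i, j) = 0)"

definition tridiagonal :: "complex mat \<Rightarrow> bool" where
  "tridiagonal T \<longleftrightarrow>
     (\<forall>i<dim_row T. \<forall>j<dim_col T. i + 1 < j \<or> j + 1 < i \<longrightarrow> T $$ (i, j) = 0)"

definition unreduced_tridiagonal :: "complex mat \<Rightarrow> bool" where
  "unreduced_tridiagonal T \<longleftrightarrow>
     tridiagonal T \<and> (\<forall>i. i + 1 < dim_row T \<longrightarrow> T $$ (i + 1, i) \<noteq> 0)"

definition Pi_upper_triangular :: "nat \<Rightarrow> complex mat \<Rightarrow> bool" where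
  "Pi_upper_triangular m R \<longleftrightarrow>
     (\<exists>R1 R2. R1 \<in> carrier_mat m m \<and> R2 \<in> carrier_mat m m \<and>
        R = four_block_mat R1 (conj_mat R2) R2 (conj_mat R1) \<and>
        upper_triangular R1 \<and> strictly_upper_triangular R2)"

definition Gamma_QR :: "nat \<Rightarrow> nat \<Rightarrow> complex mat \<Rightarrow> complex mat \<Rightarrow> complex mat \<Rightarrow> bool" where
  "Gamma_QR n m G Q R \<longleftrightarrow>
     G \<in> carrier_mat (2 * n) (2 * m) \<and> G * Pi_mat m = Pi_mat n * conj_mat G \<and>
     Q \<in> carrier_mat (2 * n) (2 * m) \<and> Q * Pi_mat m = Pi_mat n * conj_mat Q \<and>
     mat_adjoint Q * Gamma0_mat n * Q \<in> Gamma_mats m \<and>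
     Pi_upper_triangular m R \<and>
     G = Q * R"

(* Pi_Krylov n H q k is the (k+1)-th order matrix, with 2k+2 columns. *)

definition Pi_Krylov :: "nat \<Rightarrow> complex mat \<Rightarrow> complex vec \<Rightarrow> nat \<Rightarrow> complex mat" where
  "Pi_Krylov n H q k =
     mat_of_cols (2 * n)
       (map (\<lambda>j. (H ^\<^sub>m j) *\<^sub>v q) [0..<k + 1] @
        map (\<lambda>j. Pi_mat n *\<^sub>v ((conj_mat H ^\<^sub>m j) *\<^sub>v conj_vec q)) [0..<k + 1])"

definition Q_even :: "nat \<Rightarrow> complex mat \<Rightarrow> complex mat" where
  "Q_even n U = mat_of_cols (2 * n) (cols U @ cols (Pi_mat n * conj_mat U))"

definition Q_ext :: "nat \<Rightarrow> complex mat \<Rightarrow> complex vec \<Rightarrow> complex mat" where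
  "Q_ext n U u =
     mat_of_cols (2 * n)
       (cols U @ [u] @ cols (Pi_mat n * conj_mat U) @ [Pi_mat n *\<^sub>v conj_vec u])"

(* The four block rows have heights k, 1, k, 1.  Since unit_vec is 0-based, the k-th
   column of the identity is unit_vec k (k - 1). *)

definition T_tilde :: "nat \<Rightarrow> complex mat \<Rightarrow> complex mat \<Rightarrow> complex \<Rightarrow> complex \<Rightarrow> complex mat" where
  "T_tilde k T11 T21 \<zeta> \<tau> =
     four_block_mat
       (T11 @\<^sub>r mat_of_rows k [(\<zeta> * \<tau>) \<cdot>\<^sub>v unit_vec k (k - 1)])
       (- conj_mat T21 @\<^sub>r 0\<^sub>m 1 k)
       (T21 @\<^sub>r 0\<^sub>m 1 k)
       (- conj_mat T11 @\<^sub>r mat_of_rows k [(- cnj \<zeta> * cnj \<tau>) \<cdot>\<^sub>v unit_vec k (k - 1)])"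

end

theory Submission
  imports Defs
begin

text \<open>
  Let \<open>J v = \<Pi> (cnj v)\<close>; this is an antilinear involution. Each of the matrices
  \<open>Q\<^sub>2\<^sub>k\<close>, \<open>Q\<^sub>2\<^sub>k\<^sub>+\<^sub>2\<close>, the Krylov matrix and a matrix with blocks
  \<open>R\<^sub>1\<close>, \<open>cnj R\<^sub>2\<close>, \<open>R\<^sub>2\<close>, \<open>cnj R\<^sub>1\<close> consists of a list of columns followed by the images of these
  columns under \<open>J\<close> (\<open>paired\<close>). Multiplication by such a matrix commutes with \<open>J\<close>
  (\<open>paired_mult_Pi_conj\<close>), so a product of two of them is determined by the first halves of their
  columns (\<open>paired_mult_paired\<close>).

  It therefore suffices to write \<open>H\<^sup>j q\<^sub>1 = Q c\<^sub>j\<close> for \<open>j \<le> k\<close> with coordinate vectors \<open>c\<^sub>j\<close> whose upper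
  half ends exactly at position \<open>j\<close> and whose lower half ends before position \<open>j\<close>
  (\<open>Pi_degree\<close>). They exist by induction: \<open>c\<^sub>0\<close> is a unit vector, and the relation
  \<open>H Q\<^sub>2\<^sub>k = Q\<^sub>2\<^sub>k\<^sub>+\<^sub>2 T\<close> turns multiplication by \<open>H\<close> into multiplication by \<open>T\<close>. Its two Hessenberg
  blocks raise the degree by one, the blocks formed from \<open>T\<^sub>2\<^sub>1\<close>, being diagonal, mix the halves without
  shifting indices, and the nonzero sub-diagonal entries keep the leading coordinate nonzero
  (\<open>Pi_degree_T_tilde\<close>). The step applies as long as \<open>j < k\<close>, because then \<open>c\<^sub>j\<close> vanishes
  at the two positions that \<open>Q\<^sub>2\<^sub>k\<^sub>+\<^sub>2\<close> has beyond \<open>Q\<^sub>2\<^sub>k\<close>.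

  The matrix \<open>R\<close> with paired columns \<open>c\<^sub>0, \<dots>, c\<^sub>k\<close> is then \<open>\<Pi>\<^sup>+\<close>-upper triangular. Listing its rows and
  columns as \<open>0, m, 1, m + 1, \<dots>\<close> (with \<open>m = k + 1\<close>) makes it block upper triangular with diagonal
  blocks \<open>diag(r, cnj r)\<close>, \<open>r \<noteq> 0\<close>; so back substitution shows that its kernel is trivial. The kernel
  of \<open>Q\<close> is trivial because \<open>Q\<^sup>H \<Gamma>\<^sub>0 Q\<close> is a nonsingular diagonal matrix. Hence \<open>K = Q R\<close> has
  trivial kernel, that is, full column rank.
\<close>

section \<open>Doubled vectors and the antilinear involution\<close>

definition Pi_conj :: "nat \<Rightarrow> complex vec \<Rightarrow> complex vec" where
  "Pi_conj m v = Pi_mat m *\<^sub>v conj_vec v"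

definition paired :: "nat \<Rightarrow> complex vec list \<Rightarrow> complex mat" where
  "paired n vs = mat_of_cols (2 * n) (vs @ map (Pi_conj n) vs)"

lemma Pi_mat_carrier [simp]: "Pi_mat m \<in> carrier_mat (2 * m) (2 * m)"
  unfolding Pi_mat_def by (simp add: mult_2)

lemma dim_Pi_mat [simp]: "dim_row (Pi_mat m) = 2 * m" "dim_col (Pi_mat m) = 2 * m"
  using Pi_mat_carrier[of m] by blast+

lemma Pi_conj_carrier [simp]: "Pi_conj m v \<in> carrier_vec (2 * m)"
  unfolding Pi_conj_def by (metis Pi_mat_carrier carrier_vec_dim_vec carrier_matD(1) dim_mult_mat_vec)

lemma dim_Pi_conj [simp]: "dim_vec (Pi_conj m v) = 2 * m"
  using carrier_vecD[OF Pi_conj_carrier] .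

lemma row_Pi_mat:
  assumes "i < m"
  shows "row (Pi_mat m) i = unit_vec (2 * m) (m + i)" "row (Pi_mat m) (m + i) = unit_vec (2 * m) i"
  using assms by (auto intro!: eq_vecI simp: Pi_mat_def mult_2)

lemma col_Pi_mat:
  assumes "i < m"
  shows "col (Pi_mat m) i = unit_vec (2 * m) (m + i)" "col (Pi_mat m) (m + i) = unit_vec (2 * m) i"
  using assms by (auto intro!: eq_vecI simp: Pi_mat_def mult_2)

lemma Pi_conj_index:
  assumes "v \<in> carrier_vec (2 * m)" "i < m"
  shows "Pi_conj m v $ i = cnj (v $ (m + i))" "Pi_conj m v $ (m + i) = cnj (v $ i)"
proof -
  show "Pi_conj m v $ i = cnj (v $ (m + i))" "Pi_conj m v $ (m + i) = cnj (v $ i)"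
    using assms by (simp_all add: Pi_conj_def row_Pi_mat)
qed

text \<open>
  The involution exchanges the positions \<open>i\<close> and \<open>m + i\<close>, so vectors involving it are compared
  on the two halves separately.
\<close>

lemma eq_vec_halvesI:
  assumes "v \<in> carrier_vec (2 * m)" "w \<in> carrier_vec (2 * m)"
    and "\<And>i. i < m \<Longrightarrow> v $ i = w $ i" "\<And>i. i < m \<Longrightarrow> v $ (m + i) = w $ (m + i)"
  shows "v = w"
proof (rule eq_vecI)
  fix i assume i: "i < dim_vec w"
  show "v $ i = w $ i"
  proof (cases "i < m")
    case False
    then obtain i' where "i = m + i'" by (metis le_add_diff_inverse not_less)
    then show ?thesis using assms i by auto
  qed (use assms in auto)
qed (use assms in auto)

lemma Pi_conj_Pi_conj [simp]:
  assumes "v \<in> carrier_vec (2 * m)"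
  shows "Pi_conj m (Pi_conj m v) = v"
  by (rule eq_vec_halvesI[of _ m]) (use assms in \<open>simp_all add: Pi_conj_index\<close>)

section \<open>Matrices whose second block column is the involution of the first\<close>

lemma paired_carrier [simp]: "paired n vs \<in> carrier_mat (2 * n) (2 * length vs)"
  unfolding paired_def by (metis mat_of_cols_carrier(1) length_append length_map mult_2)

lemma dim_paired [simp]:
  "dim_row (paired n vs) = 2 * n" "dim_col (paired n vs) = 2 * length vs"
  using paired_carrier[of n vs] by blast+

lemma col_paired:
  assumes "set vs \<subseteq> carrier_vec (2 * n)" "j < length vs"
  shows "col (paired n vs) j = vs ! j" "col (paired n vs) (length vs + j) = Pi_conj n (vs ! j)"
proof -
  have "vs ! j \<in> carrier_vec (2 * n)" using assms by (auto dest: nth_mem)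
  then show "col (paired n vs) j = vs ! j"
    using assms unfolding paired_def by (subst col_mat_of_cols) (auto simp: nth_append)
  show "col (paired n vs) (length vs + j) = Pi_conj n (vs ! j)"
    using assms unfolding paired_def by (subst col_mat_of_cols) (auto simp: nth_append)
qed

lemma paired_index:
  assumes "i < 2 * n" "j < length vs"
  shows "paired n vs $$ (i, j) = vs ! j $ i" "paired n vs $$ (i, length vs + j) = Pi_conj n (vs ! j) $ i"
  using assms unfolding paired_def by (simp_all add: mat_of_cols_index nth_append)

lemma sum_halves: "(\<Sum>l\<in>{0..<2 * m}. f l) = (\<Sum>l<m. f l + f (m + l))" for f :: "nat \<Rightarrow> 'a :: comm_monoid_add"
proof -
  have "(\<Sum>l\<in>{0..<2 * m}. f l) = (\<Sum>l\<in>{0..<m}. f l) + (\<Sum>l\<in>{m..<2 * m}. f l)"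
    by (simp add: sum.atLeastLessThan_concat)
  also have "(\<Sum>l\<in>{m..<2 * m}. f l) = (\<Sum>l\<in>{0..<m}. f (m + l))"
    using sum.shift_bounds_nat_ivl[of f 0 m m] by (simp add: mult_2 add.commute)
  finally show ?thesis by (simp add: sum.distrib atLeast0LessThan)
qed

lemma mult_mat_vec_halves:
  fixes M :: "'a :: semiring_0 mat"
  assumes "M \<in> carrier_mat r (2 * m)" "c \<in> carrier_vec (2 * m)" "i < r"
  shows "(M *\<^sub>v c) $ i = (\<Sum>l<m. M $$ (i, l) * c $ l + M $$ (i, m + l) * c $ (m + l))"
proof -
  have "(M *\<^sub>v c) $ i = (\<Sum>l\<in>{0..<2 * m}. M $$ (i, l) * c $ l)"
    using assms by (auto simp: scalar_prod_def intro!: sum.cong)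
  then show ?thesis by (simp only: sum_halves)
qed

lemma paired_mult_index:
  assumes "c \<in> carrier_vec (2 * length vs)" "i < 2 * n"
  shows "(paired n vs *\<^sub>v c) $ i =
    (\<Sum>l<length vs. vs ! l $ i * c $ l + Pi_conj n (vs ! l) $ i * c $ (length vs + l))"
  unfolding mult_mat_vec_halves[OF paired_carrier assms]
  by (rule sum.cong) (use assms in \<open>auto simp: paired_index\<close>)

lemma paired_mult_carrier [simp]: "paired n vs *\<^sub>v c \<in> carrier_vec (2 * n)"
  by (rule carrier_vecI) simp

text \<open>
  Since \<open>J\<close> is antilinear, \<open>J (a v + b (J v)) = cnj a (J v) + cnj b v\<close> for each column \<open>v\<close>: applying \<open>J\<close>
  to the product conjugates the coefficients of \<open>v\<close> and \<open>J v\<close> and exchanges them, as does applying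
  \<open>J\<close> to the coefficient vector.
\<close>

lemma paired_mult_Pi_conj:
  assumes vs: "set vs \<subseteq> carrier_vec (2 * n)" and c: "c \<in> carrier_vec (2 * length vs)"
  shows "paired n vs *\<^sub>v Pi_conj (length vs) c = Pi_conj n (paired n vs *\<^sub>v c)"
proof (rule eq_vec_halvesI[of _ n])
  have v: "vs ! l \<in> carrier_vec (2 * n)" if "l < length vs" for l
    using vs that by (auto dest: nth_mem)
  fix i assume i: "i < n"
  show "(paired n vs *\<^sub>v Pi_conj (length vs) c) $ i = Pi_conj n (paired n vs *\<^sub>v c) $ i"
    and "(paired n vs *\<^sub>v Pi_conj (length vs) c) $ (n + i) = Pi_conj n (paired n vs *\<^sub>v c) $ (n + i)"
    using i c by (simp_all add: Pi_conj_index paired_mult_index del: index_mult_mat_vec,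
        auto intro!: sum.cong simp: v Pi_conj_index)
qed simp_all

lemma paired_mult_paired:
  assumes vs: "set vs \<subseteq> carrier_vec (2 * n)" and cs: "set cs \<subseteq> carrier_vec (2 * length vs)"
  shows "paired n vs * paired (length vs) cs = paired n (map (\<lambda>c. paired n vs *\<^sub>v c) cs)"
    (is "?L = ?R")
proof (rule mat_col_eqI)
  fix j assume j: "j < dim_col ?R"
  have ws: "set (map (\<lambda>c. paired n vs *\<^sub>v c) cs) \<subseteq> carrier_vec (2 * n)" by auto
  have c: "cs ! l \<in> carrier_vec (2 * length vs)" if "l < length cs" for l
    using cs that by (auto dest: nth_mem)
  have L: "col ?L j = paired n vs *\<^sub>v col (paired (length vs) cs) j"
    by (rule col_mult2[OF paired_carrier paired_carrier]) (use j in simp)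
  show "col ?L j = col ?R j"
  proof (cases "j < length cs")
    case True
    then show ?thesis using L col_paired(1)[OF cs True] col_paired(1)[OF ws, of j] by simp
  next
    case False
    then obtain l where jl: "j = length cs + l" by (metis le_add_diff_inverse not_less)
    then have l: "l < length cs" using j by simp
    show ?thesis
      using L col_paired(2)[OF cs l] col_paired(2)[OF ws, of l] l paired_mult_Pi_conj[OF vs c[OF l]]
      by (simp add: jl)
  qed
qed simp_all

text \<open>
  Multiplying by \<open>\<Pi>\<close> from the right exchanges the two block columns; applying \<open>J\<close> to every column
  does the same, because \<open>J\<close> is an involution.
\<close>

lemma paired_Pi_symmetric:
  assumes vs: "set vs \<subseteq> carrier_vec (2 * n)"
  shows "paired n vs * Pi_mat (length vs) = Pi_mat n * conj_mat (paired n vs)" (is "?L = ?R")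
proof (rule mat_col_eqI)
  fix j assume "j < dim_col ?R"
  then have j: "j < 2 * length vs" by simp
  have v: "vs ! l \<in> carrier_vec (2 * n)" if "l < length vs" for l
    using vs that by (auto dest: nth_mem)
  have unit: "paired n vs *\<^sub>v unit_vec (2 * length vs) l = col (paired n vs) l"
    if "l < 2 * length vs" for l
    using that by (intro eq_vecI) auto
  have L: "col ?L j = paired n vs *\<^sub>v col (Pi_mat (length vs)) j"
    by (rule col_mult2[OF paired_carrier Pi_mat_carrier j])
  have "col (conj_mat (paired n vs)) j = conj_vec (col (paired n vs) j)"
    using j by (intro eq_vecI) auto
  then have R: "col ?R j = Pi_conj n (col (paired n vs) j)"
    unfolding Pi_conj_def using col_mult2[OF Pi_mat_carrier _ j, of "conj_mat (paired n vs)" n]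
    by simp
  show "col ?L j = col ?R j"
  proof (cases "j < length vs")
    case True
    then show ?thesis using L R col_paired[OF vs True] by (simp add: col_Pi_mat unit)
  next
    case False
    then obtain l where jl: "j = length vs + l" by (metis le_add_diff_inverse not_less)
    then have l: "l < length vs" using j by simp
    then show ?thesis using L R col_paired[OF vs l] v[OF l] by (simp add: jl col_Pi_mat unit)
  qed
qed simp_all

text \<open>
  The vector \<open>d\<close> arises from \<open>c\<close> by deleting the last entry of each half. These two entries are the
  coefficients of \<open>u\<close> and \<open>J u\<close>; once they vanish, the shorter basis suffices. This is what allows
  a relation for the shorter basis to be applied to a combination of the longer one.
\<close>

lemma paired_snoc_mult:
  assumes vs: "set vs \<subseteq> carrier_vec (2 * n)"
    and c: "c \<in> carrier_vec (2 * (length vs + 1))"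
    and zero: "c $ length vs = 0" "c $ (2 * length vs + 1) = 0"
    and d: "d = vec (2 * length vs) (\<lambda>i. if i < length vs then c $ i else c $ (i + 1))"
  shows "paired n (vs @ [u]) *\<^sub>v c = paired n vs *\<^sub>v d"
proof (rule eq_vecI)
  fix i assume "i < dim_vec (paired n vs *\<^sub>v d)"
  then have i: "i < 2 * n" by simp
  have dc: "d \<in> carrier_vec (2 * length vs)" using d by simp
  have c': "c \<in> carrier_vec (2 * length (vs @ [u]))" using c by simp
  have e: "length vs + (length vs + 1) = 2 * length vs + 1" by simp
  show "(paired n (vs @ [u]) *\<^sub>v c) $ i = (paired n vs *\<^sub>v d) $ i"
    unfolding paired_mult_index[OF c' i] paired_mult_index[OF dc i]
    using zero by (simp add: nth_append d mult_2 cong: sum.cong_simp)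
qed simp

section \<open>Coordinate vectors of increasing degree\<close>

text \<open>
  The bound on the lower half is strict, as in the definition of a \<open>\<Pi>\<^sup>+\<close>-upper triangular matrix: this
  is what decouples the unknowns \<open>x\<^sub>i\<close> and \<open>x\<^bsub>m+i\<^esub>\<close> in back substitution.
\<close>

definition Pi_degree :: "nat \<Rightarrow> nat \<Rightarrow> complex vec \<Rightarrow> bool" where
  "Pi_degree m j c \<longleftrightarrow> c \<in> carrier_vec (2 * m) \<and> c $ j \<noteq> 0 \<and>
     (\<forall>i<m. (j < i \<longrightarrow> c $ i = 0) \<and> (j \<le> i \<longrightarrow> c $ (m + i) = 0))"

lemma Pi_upper_triangular_paired:
  assumes cs: "length cs = m" "\<And>j. j < m \<Longrightarrow> Pi_degree m j (cs ! j)"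
  shows "Pi_upper_triangular m (paired m cs)"
proof -
  have c: "cs ! j \<in> carrier_vec (2 * m)" if "j < m" for j
    using cs(2)[OF that] by (simp add: Pi_degree_def)
  define R1 where "R1 = mat m m (\<lambda>(i, j). cs ! j $ i)"
  define R2 where "R2 = mat m m (\<lambda>(i, j). cs ! j $ (m + i))"
  have "paired m cs = four_block_mat R1 (conj_mat R2) R2 (conj_mat R1)" (is "_ = ?F")
  proof (rule eq_matI)
    fix i j assume "i < dim_row ?F" "j < dim_col ?F"
    then have ij: "i < 2 * m" "j < 2 * m" by (auto simp: R1_def)
    obtain l where l: "l < m" "j = l \<or> j = m + l"
      using ij by (metis le_add_diff_inverse not_less mult_2 nat_add_left_cancel_less)
    obtain h where h: "h < m" "i = h \<or> i = m + h"
      using ij by (metis le_add_diff_inverse not_less mult_2 nat_add_left_cancel_less)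
    have p: "paired m cs $$ (i, l) = cs ! l $ i" "paired m cs $$ (i, m + l) = Pi_conj m (cs ! l) $ i"
      using paired_index[OF ij(1), of l cs] l cs by auto
    show "paired m cs $$ (i, j) = ?F $$ (i, j)"
      using l(2) h(2)
      by (elim disjE) (use p l(1) h(1) c[OF l(1)] in \<open>simp_all add: R1_def R2_def Pi_conj_index\<close>)
  qed (use cs in \<open>auto simp: R1_def\<close>)
  moreover have "upper_triangular R1" "strictly_upper_triangular R2"
    using cs(2) by (auto simp: R1_def R2_def upper_triangular_def strictly_upper_triangular_def Pi_degree_def)
  ultimately show ?thesis
    unfolding Pi_upper_triangular_def
    by (intro exI[of _ R1] exI[of _ R2]) (simp add: R1_def R2_def)
qed

text \<open>
  Back substitution in pairs: once \<open>x\<^sub>l\<close> and \<open>x\<^bsub>m+l\<^esub>\<close> vanish for all \<open>l > i\<close>, row \<open>i\<close> of the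
  system reads \<open>r x\<^sub>i = 0\<close> and row \<open>m + i\<close> reads \<open>cnj r x\<^bsub>m+i\<^esub> = 0\<close>, where \<open>r \<noteq> 0\<close> is the leading
  coordinate of the \<open>i\<close>-th column.
\<close>

lemma Pi_degree_kernel_trivial:
  assumes cs: "length cs = m" "\<And>j. j < m \<Longrightarrow> Pi_degree m j (cs ! j)"
    and x: "x \<in> carrier_vec (2 * m)" "paired m cs *\<^sub>v x = 0\<^sub>v (2 * m)"
  shows "x = 0\<^sub>v (2 * m)"
proof -
  have c: "cs ! j \<in> carrier_vec (2 * m)" if "j < m" for j
    using cs(2)[OF that] by (simp add: Pi_degree_def)
  have x': "x \<in> carrier_vec (2 * length cs)" using x cs by simp
  have z: "i < m \<Longrightarrow> x $ i = 0 \<and> x $ (m + i) = 0" for i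
  proof (induction "m - i" arbitrary: i rule: less_induct)
    case less
    have above: "x $ l = 0 \<and> x $ (m + l) = 0" if "i < l" "l < m" for l
      by (rule less(1)) (use that in auto)
    have d: "cs ! i $ i \<noteq> 0" using cs(2)[OF less(2)] by (simp add: Pi_degree_def)
    have t: "cs ! l $ i = 0" if "l < i" for l
      using cs(2)[of l] that less(2) by (simp add: Pi_degree_def)
    have b: "cs ! l $ (m + i) = 0" if "l \<le> i" for l
      using cs(2)[of l] that less(2) by (simp add: Pi_degree_def)
    have "0 = (paired m cs *\<^sub>v x) $ i" using x less(2) by simp
    also have "\<dots> = (\<Sum>l<m. cs ! l $ i * x $ l + Pi_conj m (cs ! l) $ i * x $ (m + l))"
      using paired_mult_index[OF x', of i m] less(2) cs(1) by simp
    \<comment> \<open>Columns before the \<open>i\<close>-th have too small a degree, later unknowns are already known to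
      vanish, and the partner of column \<open>i\<close> does not reach row \<open>i\<close> by strictness.\<close>
    also have "\<dots> = (\<Sum>l<m. if l = i then cs ! i $ i * x $ i else 0)"
    proof (rule sum.cong)
      fix l assume "l \<in> {..<m}"
      then have l: "l < m" by simp
      show "cs ! l $ i * x $ l + Pi_conj m (cs ! l) $ i * x $ (m + l) =
          (if l = i then cs ! i $ i * x $ i else 0)"
        using c[OF l] less(2) above[OF _ l] t[of l] b[of l]
        by (cases l i rule: linorder_cases) (auto simp: Pi_conj_index)
    qed simp
    also have "\<dots> = cs ! i $ i * x $ i" using less(2) by simp
    finally have 1: "x $ i = 0" using d by simp
    have "0 = (paired m cs *\<^sub>v x) $ (m + i)" using x less(2) by simp
    also have "\<dots> = (\<Sum>l<m. cs ! l $ (m + i) * x $ l + Pi_conj m (cs ! l) $ (m + i) * x $ (m + l))"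
      using paired_mult_index[OF x', of "m + i" m] less(2) cs(1) by simp
    also have "\<dots> = (\<Sum>l<m. if l = i then cnj (cs ! i $ i) * x $ (m + i) else 0)"
    proof (rule sum.cong)
      fix l assume "l \<in> {..<m}"
      then have l: "l < m" by simp
      show "cs ! l $ (m + i) * x $ l + Pi_conj m (cs ! l) $ (m + i) * x $ (m + l) =
          (if l = i then cnj (cs ! i $ i) * x $ (m + i) else 0)"
        using c[OF l] less(2) above[OF _ l] t[of l] b[of l]
        by (cases l i rule: linorder_cases) (auto simp: Pi_conj_index)
    qed simp
    also have "\<dots> = cnj (cs ! i $ i) * x $ (m + i)" using less(2) by simp
    finally show ?case using 1 d by simp
  qed
  show ?thesis by (rule eq_vec_halvesI[of _ m]) (use x z in auto)
qed

section \<open>Trivial kernels\<close>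

lemma trivial_kernel_imp_invertible_mat:
  fixes M :: "'a :: field mat"
  assumes M: "M \<in> carrier_mat n n"
    and ker: "\<And>x. x \<in> carrier_vec n \<Longrightarrow> M *\<^sub>v x = 0\<^sub>v n \<Longrightarrow> x = 0\<^sub>v n"
  shows "invertible_mat M"
proof -
  have "det M \<noteq> 0" using det_0_iff_vec_prod_zero_field[OF M] ker by blast
  from det_non_zero_imp_unit[OF M this, of "()"]
  obtain N where "N \<in> carrier_mat n n" "N * M = 1\<^sub>m n" "M * N = 1\<^sub>m n"
    unfolding Units_def by (auto simp: ring_mat_simps)
  then show ?thesis
    using M unfolding invertible_mat_def inverts_mat_def by auto
qed

text \<open>
  The rank is the dimension of the span of the \<^emph>\<open>set\<close> of columns, so distinctness of the columns
  has to be established as well: equal columns \<open>i \<noteq> j\<close> would put the difference of two unit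
  vectors into the kernel.
\<close>

lemma (in vec_space) trivial_kernel_imp_full_rank:
  assumes M: "M \<in> carrier_mat n nc"
    and ker: "\<And>x. x \<in> carrier_vec nc \<Longrightarrow> M *\<^sub>v x = 0\<^sub>v n \<Longrightarrow> x = 0\<^sub>v nc"
  shows "rank M = nc"
proof (rule lin_indpt_full_rank[OF M])
  show dist: "distinct (cols M)"
    unfolding distinct_conv_nth
  proof (intro allI impI notI)
    fix i j
    assume "i < length (cols M)" "j < length (cols M)" "i \<noteq> j" and eq: "cols M ! i = cols M ! j"
    then have ij: "i < nc" "j < nc" "i \<noteq> j" using M by auto
    have u: "M *\<^sub>v unit_vec nc l = col M l" if "l < nc" for l
      using M that by (intro eq_vecI) auto
    have "M *\<^sub>v (unit_vec nc i - unit_vec nc j) = col M i - col M j"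
      using M ij by (simp add: mult_minus_distrib_mat_vec[OF M] u)
    also have "\<dots> = 0\<^sub>v n" using eq ij M by auto
    finally have "unit_vec nc i - unit_vec nc j = (0\<^sub>v nc :: 'a vec)"
      by (intro ker) auto
    then have "(unit_vec nc i - unit_vec nc j :: 'a vec) $ i = 0\<^sub>v nc $ i" by simp
    then show False using ij by simp
  qed
  show "lin_indpt (set (cols M))"
    using lin_depE[OF M _ dist] ker by metis
qed

lemma Gamma_mats_kernel_trivial:
  assumes G: "\<Gamma> \<in> Gamma_mats m"
    and x: "x \<in> carrier_vec (2 * m)" "\<Gamma> *\<^sub>v x = 0\<^sub>v (2 * m)"
  shows "x = 0\<^sub>v (2 * m)"
proof -
  obtain J where \<Gamma>: "\<Gamma> = four_block_mat J (0\<^sub>m m m) (0\<^sub>m m m) (- J)"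
    and J: "J \<in> carrier_mat m m" "diagonal_mat J" "\<forall>i<m. J $$ (i, i) \<in> {1, -1}"
    using G unfolding Gamma_mats_def by blast
  have \<Gamma>c: "\<Gamma> \<in> carrier_mat (2 * m) (2 * m)" using J by (simp add: \<Gamma> mult_2)
  have off: "J $$ (i, l) = 0" if "i < m" "l < m" "l \<noteq> i" for i l
    using J that unfolding diagonal_mat_def by auto
  have "(\<Gamma> *\<^sub>v x) $ i = J $$ (i, i) * x $ i" "(\<Gamma> *\<^sub>v x) $ (m + i) = - J $$ (i, i) * x $ (m + i)"
    if i: "i < m" for i
  proof -
    have i1: "i < 2 * m" using i by simp
    have "(\<Gamma> *\<^sub>v x) $ i = (\<Sum>l<m. if l = i then J $$ (i, i) * x $ i else 0)"
      unfolding mult_mat_vec_halves[OF \<Gamma>c x(1) i1]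
      by (rule sum.cong) (use i J off in \<open>auto simp: \<Gamma>\<close>)
    then show "(\<Gamma> *\<^sub>v x) $ i = J $$ (i, i) * x $ i" using i by simp
    have i2: "m + i < 2 * m" using i by simp
    have "(\<Gamma> *\<^sub>v x) $ (m + i) = (\<Sum>l<m. if l = i then - J $$ (i, i) * x $ (m + i) else 0)"
      unfolding mult_mat_vec_halves[OF \<Gamma>c x(1) i2]
      by (rule sum.cong) (use i J off in \<open>auto simp: \<Gamma>\<close>)
    then show "(\<Gamma> *\<^sub>v x) $ (m + i) = - J $$ (i, i) * x $ (m + i)" using i by simp
  qed
  then have "x $ i = 0" "x $ (m + i) = 0" if "i < m" for i
    using x(2) that J(3) by (force simp del: index_mult_mat_vec)+
  then show ?thesis by (intro eq_vec_halvesI[of _ m]) (use x in auto)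
qed

section \<open>The Lanczos recurrence in coordinates\<close>

text \<open>
  Only the zero pattern of the coefficient matrix and its sub-diagonal matter for the degree.
  The row with the entry \<open>\<zeta> * \<tau>\<close> extends the tridiagonal block to a \<open>(k + 1) \<times> k\<close> Hessenberg matrix
  whose last sub-diagonal entry is \<open>\<zeta> * \<tau>\<close>, so that the cases \<open>l + 1 < k\<close> and \<open>l + 1 = k\<close> can be
  treated uniformly.
\<close>

lemma T_tilde_index:
  assumes T11: "T11 \<in> carrier_mat k k" "unreduced_tridiagonal T11"
    and T21: "T21 \<in> carrier_mat k k" "diagonal_mat T21"
    and l: "l < k" and i: "i \<le> k"
  shows "l + 1 < i \<Longrightarrow> T_tilde k T11 T21 \<zeta> \<tau> $$ (i, l) = 0"
    and "l < i \<Longrightarrow> T_tilde k T11 T21 \<zeta> \<tau> $$ (i, k + l) = 0"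
    and "l < i \<Longrightarrow> T_tilde k T11 T21 \<zeta> \<tau> $$ (k + 1 + i, l) = 0"
    and "l + 1 < i \<Longrightarrow> T_tilde k T11 T21 \<zeta> \<tau> $$ (k + 1 + i, k + l) = 0"
    and "\<zeta> * \<tau> \<noteq> 0 \<Longrightarrow> T_tilde k T11 T21 \<zeta> \<tau> $$ (l + 1, l) \<noteq> 0"
proof -
  have T: "T11 $$ (i, l) = 0" if "l + 1 < i" "i < k" for i l
    using that T11 unfolding unreduced_tridiagonal_def tridiagonal_def by auto
  have S: "T11 $$ (Suc l, l) \<noteq> 0" if "Suc l < k"
    using that T11 unfolding unreduced_tridiagonal_def by auto
  have D: "T21 $$ (i, l) = 0" if "l < i" "i < k" for i l
    using that T21 unfolding diagonal_mat_def by auto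
  note d = T_tilde_def append_rows_def mat_of_rows_index
  show "l + 1 < i \<Longrightarrow> T_tilde k T11 T21 \<zeta> \<tau> $$ (i, l) = 0"
    and "l < i \<Longrightarrow> T_tilde k T11 T21 \<zeta> \<tau> $$ (i, k + l) = 0"
    and "l < i \<Longrightarrow> T_tilde k T11 T21 \<zeta> \<tau> $$ (k + 1 + i, l) = 0"
    and "l + 1 < i \<Longrightarrow> T_tilde k T11 T21 \<zeta> \<tau> $$ (k + 1 + i, k + l) = 0"
    and "\<zeta> * \<tau> \<noteq> 0 \<Longrightarrow> T_tilde k T11 T21 \<zeta> \<tau> $$ (l + 1, l) \<noteq> 0"
    using l i T11(1) T21(1) T S D by (auto simp: d)
qed

text \<open>
  In the upper half, the Hessenberg block moves the end of the support from \<open>j\<close> to \<open>j + 1\<close>, with new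
  leading coordinate the product of the old one and a sub-diagonal entry; the lower half of \<open>d\<close> ends
  before \<open>j\<close> and the diagonal block leaves it there. In the lower half, the diagonal block contributes
  entries up to \<open>j\<close>, and the Hessenberg block moves entries before \<open>j\<close> by at most one position,
  that is, up to \<open>j\<close> again. This is the strict bound for degree \<open>j + 1\<close>.
\<close>

lemma Pi_degree_T_tilde:
  assumes T11: "T11 \<in> carrier_mat k k" "unreduced_tridiagonal T11"
    and T21: "T21 \<in> carrier_mat k k" "diagonal_mat T21"
    and nz: "\<zeta> * \<tau> \<noteq> 0" and j: "j < k"
    and c: "Pi_degree (k + 1) j c"
    and d: "d = vec (2 * k) (\<lambda>i. if i < k then c $ i else c $ (i + 1))"
  shows "Pi_degree (k + 1) (j + 1) (T_tilde k T11 T21 \<zeta> \<tau> *\<^sub>v d)"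
proof -
  let ?T = "T_tilde k T11 T21 \<zeta> \<tau>"
  note Ti = T_tilde_index[OF T11 T21]
  have Tc: "?T \<in> carrier_mat (2 * (k + 1)) (2 * k)"
    unfolding T_tilde_def append_rows_def using T11(1) T21(1) by auto
  have dc: "d \<in> carrier_vec (2 * k)" using d by simp
  have d1: "d $ l = 0" if "j < l" "l < k" for l
    using that c by (simp add: d Pi_degree_def)
  have d2: "d $ (k + l) = 0" if "j \<le> l" "l < k" for l
  proof -
    have "d $ (k + l) = c $ (k + 1 + l)" using that by (simp add: d)
    then show ?thesis using that c unfolding Pi_degree_def by simp
  qed
  have dj: "d $ j \<noteq> 0" using j c by (simp add: d Pi_degree_def)
  have idx: "(?T *\<^sub>v d) $ i = (\<Sum>l<k. ?T $$ (i, l) * d $ l + ?T $$ (i, k + l) * d $ (k + l))"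
    if "i < 2 * (k + 1)" for i
    by (rule mult_mat_vec_halves[OF Tc dc that])
  have top: "(?T *\<^sub>v d) $ i = 0" if "j + 1 < i" "i < k + 1" for i
  proof -
    have "i < 2 * (k + 1)" using that by simp
    moreover have "?T $$ (i, l) * d $ l + ?T $$ (i, k + l) * d $ (k + l) = 0" if "l < k" for l
      using \<open>j + 1 < i\<close> \<open>i < k + 1\<close> that Ti(1)[of l i] Ti(2)[of l i] d1[of l] d2[of l]
      by (cases "l \<le> j") auto
    ultimately show ?thesis by (simp add: idx del: index_mult_mat_vec)
  qed
  have bot: "(?T *\<^sub>v d) $ (k + 1 + i) = 0" if "j + 1 \<le> i" "i < k + 1" for i
  proof -
    have "k + 1 + i < 2 * (k + 1)" using that by simp
    moreover have "?T $$ (k + 1 + i, l) * d $ l + ?T $$ (k + 1 + i, k + l) * d $ (k + l) = 0" if "l < k" for l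
      using \<open>j + 1 \<le> i\<close> \<open>i < k + 1\<close> that Ti(3)[of l i] Ti(4)[of l i] d1[of l] d2[of l]
      by (cases l j rule: linorder_cases) auto
    ultimately show ?thesis by (simp only: idx) simp
  qed
  have "j + 1 < 2 * (k + 1)" using j by simp
  then have "(?T *\<^sub>v d) $ (j + 1) =
      (\<Sum>l<k. ?T $$ (j + 1, l) * d $ l + ?T $$ (j + 1, k + l) * d $ (k + l))"
    by (rule idx)
  also have "\<dots> = (\<Sum>l<k. if l = j then ?T $$ (j + 1, j) * d $ j else 0)"
  proof (rule sum.cong)
    fix l assume "l \<in> {..<k}"
    then show "?T $$ (j + 1, l) * d $ l + ?T $$ (j + 1, k + l) * d $ (k + l) =
        (if l = j then ?T $$ (j + 1, j) * d $ j else 0)"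
      using j Ti(1)[of l "j + 1"] Ti(2)[of l "j + 1"] d1[of l] d2[of l]
      by (cases l j rule: linorder_cases) auto
  qed simp
  also have "\<dots> = ?T $$ (j + 1, j) * d $ j" using j by simp
  also have "\<dots> \<noteq> 0" using Ti(5)[OF j, of "j + 1"] j nz dj by simp
  finally have "(?T *\<^sub>v d) $ (j + 1) \<noteq> 0" .
  moreover have "?T *\<^sub>v d \<in> carrier_vec (2 * (k + 1))" using Tc by (rule mult_mat_vec_carrier) (rule dc)
  ultimately show ?thesis
    unfolding Pi_degree_def using top bot by blast
qed

lemma cols_Pi_mult_conj:
  assumes U: "U \<in> carrier_mat (2 * n) k"
  shows "cols (Pi_mat n * conj_mat U) = map (Pi_conj n) (cols U)"
proof (rule nth_equalityI)
  fix i assume "i < length (cols (Pi_mat n * conj_mat U))"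
  then have i: "i < k" using U by simp
  have "col (conj_mat U) i = conj_vec (col U i)" using U i by (intro eq_vecI) auto
  then show "cols (Pi_mat n * conj_mat U) ! i = map (Pi_conj n) (cols U) ! i"
    using U i col_mult2[OF Pi_mat_carrier _ i, of "conj_mat U" n] by (simp add: Pi_conj_def)
qed (use U in simp)

lemma Q_even_eq_paired:
  assumes "U \<in> carrier_mat (2 * n) k"
  shows "Q_even n U = paired n (cols U)"
  unfolding Q_even_def paired_def cols_Pi_mult_conj[OF assms] ..

lemma Q_ext_eq_paired:
  assumes "U \<in> carrier_mat (2 * n) k"
  shows "Q_ext n U u = paired n (cols U @ [u])"
  unfolding Q_ext_def paired_def cols_Pi_mult_conj[OF assms] by (simp add: Pi_conj_def)

text \<open>
  As conjugation is a ring homomorphism, the second half of the Krylov matrix consists of the vectors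
  \<open>\<Pi> (cnj (H\<^sup>j q))\<close>.
\<close>

lemma Pi_Krylov_eq_paired:
  assumes H: "H \<in> carrier_mat (2 * n) (2 * n)" and q: "q \<in> carrier_vec (2 * n)"
  shows "Pi_Krylov n H q k = paired n (map (\<lambda>j. (H ^\<^sub>m j) *\<^sub>v q) [0..<k + 1])"
proof -
  interpret cnj: semiring_hom cnj by unfold_locales auto
  have "(conj_mat H ^\<^sub>m j) *\<^sub>v conj_vec q = conj_vec ((H ^\<^sub>m j) *\<^sub>v q)" for j
    unfolding cnj.mat_hom_pow[OF H, symmetric]
    by (rule cnj.mult_mat_vec_hom[symmetric, OF pow_carrier_mat[OF H] q])
  then show ?thesis unfolding Pi_Krylov_def paired_def by (simp add: Pi_conj_def comp_def del: upt_Suc)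
qed

text \<open>
  Matrix powers are defined with the new factor on the right, whereas the induction on Krylov
  vectors applies the matrix once more from the left.
\<close>

lemma pow_mat_Suc_mult_vec:
  assumes H: "H \<in> carrier_mat n n" and q: "q \<in> carrier_vec n"
  shows "(H ^\<^sub>m Suc j) *\<^sub>v q = H *\<^sub>v ((H ^\<^sub>m j) *\<^sub>v q)"
  using q
proof (induction j arbitrary: q)
  case 0
  then show ?case using H by simp
next
  case (Suc j)
  have P: "H ^\<^sub>m i \<in> carrier_mat n n" for i by (rule pow_carrier_mat[OF H])
  have Hq: "H *\<^sub>v q \<in> carrier_vec n" using H Suc.prems by simp
  have "(H ^\<^sub>m Suc (Suc j)) *\<^sub>v q = (H ^\<^sub>m Suc j) *\<^sub>v (H *\<^sub>v q)"
    using assoc_mult_mat_vec[OF P[of "Suc j"] H Suc.prems] by simp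
  also have "\<dots> = H *\<^sub>v ((H ^\<^sub>m j) *\<^sub>v (H *\<^sub>v q))" by (rule Suc.IH[OF Hq])
  also have "(H ^\<^sub>m j) *\<^sub>v (H *\<^sub>v q) = (H ^\<^sub>m Suc j) *\<^sub>v q"
    using assoc_mult_mat_vec[OF P[of j] H Suc.prems] by simp
  finally show ?case .
qed

text \<open>
  In the induction step, \<open>j < k\<close> ensures that the coordinates found so far do not involve the last
  vector \<open>u\<close> or its image under \<open>J\<close>, so the relation for \<open>H Q\<^sub>2\<^sub>k\<close> applies to them.
\<close>

lemma Krylov_vector_coordinates:
  assumes U: "U \<in> carrier_mat (2 * n) k" and u: "u \<in> carrier_vec (2 * n)"
    and H: "H \<in> carrier_mat (2 * n) (2 * n)"
    and T11: "T11 \<in> carrier_mat k k" "unreduced_tridiagonal T11"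
    and T21: "T21 \<in> carrier_mat k k" "diagonal_mat T21"
    and nz: "\<zeta> * \<tau> \<noteq> 0"
    and relation: "H * Q_even n U = Q_ext n U u * T_tilde k T11 T21 \<zeta> \<tau>"
    and j: "j \<le> k"
  shows "\<exists>c. Pi_degree (k + 1) j c \<and> (H ^\<^sub>m j) *\<^sub>v col (Q_ext n U u) 0 = Q_ext n U u *\<^sub>v c"
  using j
proof (induction j)
  case 0
  have "dim_row (Q_ext n U u) = 2 * n" "dim_col (Q_ext n U u) = 2 * (k + 1)"
    unfolding Q_ext_eq_paired[OF U] using U by auto
  moreover from this have "col (Q_ext n U u) 0 \<in> carrier_vec (2 * n)" by (metis carrier_vec_dim_vec dim_col)
  ultimately have "(H ^\<^sub>m 0) *\<^sub>v col (Q_ext n U u) 0 = Q_ext n U u *\<^sub>v unit_vec (2 * (k + 1)) 0"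
    using H by (intro eq_vecI) auto
  moreover have "Pi_degree (k + 1) 0 (unit_vec (2 * (k + 1)) 0)"
    by (auto simp: Pi_degree_def)
  ultimately show ?case by blast
next
  case (Suc j)
  then obtain c where c: "Pi_degree (k + 1) j c"
    and eq: "(H ^\<^sub>m j) *\<^sub>v col (Q_ext n U u) 0 = Q_ext n U u *\<^sub>v c"
    by auto
  let ?T = "T_tilde k T11 T21 \<zeta> \<tau>"
  have jk: "j < k" using Suc.prems by simp
  define d where "d = vec (2 * k) (\<lambda>i. if i < k then c $ i else c $ (i + 1))"
  have len: "length (cols U) = k" and cU: "set (cols U) \<subseteq> carrier_vec (2 * n)"
    using U cols_dim[of U] unfolding carrier_matD(1)[OF U] by simp_all
  have cc: "c \<in> carrier_vec (2 * (k + 1))" and c0: "c $ k = 0"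
    using c jk by (auto simp: Pi_degree_def)
  have "c $ (k + 1 + k) = 0" using c jk unfolding Pi_degree_def by simp
  then have c1: "c $ (2 * k + 1) = 0" by (simp add: mult_2)
  have drop: "Q_ext n U u *\<^sub>v c = Q_even n U *\<^sub>v d"
    unfolding Q_ext_eq_paired[OF U] Q_even_eq_paired[OF U]
    by (rule paired_snoc_mult[OF cU]) (use cc c0 c1 in \<open>simp_all add: carrier_matD(2)[OF U] d_def\<close>)
  have Qe: "Q_even n U \<in> carrier_mat (2 * n) (2 * k)"
    unfolding Q_even_eq_paired[OF U] using paired_carrier[of n "cols U"] len by simp
  have Qx: "Q_ext n U u \<in> carrier_mat (2 * n) (2 * (k + 1))"
    unfolding Q_ext_eq_paired[OF U] using paired_carrier[of n "cols U @ [u]"] len by simp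
  have Tc: "?T \<in> carrier_mat (2 * (k + 1)) (2 * k)"
    unfolding T_tilde_def append_rows_def using T11(1) T21(1) by auto
  have dc: "d \<in> carrier_vec (2 * k)" by (simp add: d_def)
  have q: "col (Q_ext n U u) 0 \<in> carrier_vec (2 * n)"
    using carrier_matD(1)[OF Qx] by (metis carrier_vec_dim_vec dim_col)
  have "(H ^\<^sub>m Suc j) *\<^sub>v col (Q_ext n U u) 0 = H *\<^sub>v (Q_even n U *\<^sub>v d)"
    unfolding pow_mat_Suc_mult_vec[OF H q] eq drop ..
  also have "\<dots> = (H * Q_even n U) *\<^sub>v d" by (rule assoc_mult_mat_vec[symmetric, OF H Qe dc])
  also have "\<dots> = Q_ext n U u *\<^sub>v (?T *\<^sub>v d)"
    unfolding relation by (rule assoc_mult_mat_vec[OF Qx Tc dc])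
  finally show ?case
    using Pi_degree_T_tilde[OF T11 T21 nz jk c d_def] by auto
qed

theorem theorem4p4:
  fixes n k :: nat
    and A B U T11 T21 \<Gamma> :: "complex mat"
    and u q1 :: "complex vec"
    and \<zeta> \<tau> :: complex
  assumes A: "A \<in> carrier_mat n n" "mat_adjoint A = A"
    and B: "B \<in> carrier_mat n n" "transpose_mat B = B"
    and k: "1 \<le> k"
    and U: "U \<in> carrier_mat (2 * n) k"
    and u: "u \<in> carrier_vec (2 * n)"
    and Gamma: "\<Gamma> \<in> Gamma_mats (k + 1)"
      "mat_adjoint (Q_ext n U u) * Gamma0_mat n * Q_ext n U u = \<Gamma>"
    and T11: "T11 \<in> carrier_mat k k" "unreduced_tridiagonal T11"
    and T21: "T21 \<in> carrier_mat k k" "diagonal_mat T21"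
    and sub_diagonal_last: "\<zeta> * \<tau> \<noteq> 0"
    and relation: "bse_mat A B * Q_even n U = Q_ext n U u * T_tilde k T11 T21 \<zeta> \<tau>"
    and q1: "q1 = col (Q_ext n U u) 0"
  shows "(\<exists>R. R \<in> carrier_mat (2 * k + 2) (2 * k + 2) \<and> invertible_mat R \<and>
            Gamma_QR n (k + 1) (Pi_Krylov n (bse_mat A B) q1 k) (Q_ext n U u) R) \<and>
         vec_space.rank (2 * n) (Pi_Krylov n (bse_mat A B) q1 k) = 2 * k + 2"
proof -
  let ?H = "bse_mat A B" and ?Q = "Q_ext n U u" and ?m = "k + 1"
  let ?K = "Pi_Krylov n ?H q1 k"
  define vs where "vs = cols U @ [u]"
  have len: "length vs = ?m" using U by (simp add: vs_def)
  have vs: "set vs \<subseteq> carrier_vec (2 * n)" using u cols_dim[of U] unfolding carrier_matD(1)[OF U] by (simp add: vs_def)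
  have Q: "?Q = paired n vs" unfolding vs_def by (rule Q_ext_eq_paired[OF U])
  have Qc: "?Q \<in> carrier_mat (2 * n) (2 * ?m)" unfolding Q using paired_carrier[of n vs] len by simp
  have H: "?H \<in> carrier_mat (2 * n) (2 * n)" using A(1) B(1) by (simp add: bse_mat_def mult_2)
  have q: "q1 \<in> carrier_vec (2 * n)" unfolding q1 using carrier_matD(1)[OF Qc] by (metis carrier_vec_dim_vec dim_col)
  have "\<forall>j\<in>{0..<?m}. \<exists>c. Pi_degree ?m j c \<and> (?H ^\<^sub>m j) *\<^sub>v q1 = ?Q *\<^sub>v c"
    using Krylov_vector_coordinates[OF U u H T11 T21 sub_diagonal_last relation] by (auto simp: q1)
  then obtain c where c: "Pi_degree ?m j (c j)" "(?H ^\<^sub>m j) *\<^sub>v q1 = ?Q *\<^sub>v c j" if "j < ?m" for j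
    by (metis atLeastLessThan_iff le0)
  define cs where "cs = map c [0..<?m]"
  have cs: "length cs = ?m" "\<And>j. j < ?m \<Longrightarrow> Pi_degree ?m j (cs ! j)"
    using c(1) by (auto simp: cs_def simp del: upt_Suc)
  have csc: "set cs \<subseteq> carrier_vec (2 * ?m)"
    using cs unfolding Pi_degree_def by (metis in_set_conv_nth subsetI)
  define R where "R = paired ?m cs"
  have Rc: "R \<in> carrier_mat (2 * ?m) (2 * ?m)" unfolding R_def using paired_carrier[of ?m cs] cs(1) by simp
  have Kry: "map (\<lambda>j. (?H ^\<^sub>m j) *\<^sub>v q1) [0..<?m] = map (\<lambda>c. ?Q *\<^sub>v c) cs"
    unfolding cs_def map_map by (rule map_cong) (use c(2) in auto)
  have Kp: "?K = paired n (map (\<lambda>c. ?Q *\<^sub>v c) cs)"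
    unfolding Pi_Krylov_eq_paired[OF H q] Kry ..
  have KQR: "?K = ?Q * R"
    unfolding Kp R_def using paired_mult_paired[OF vs, of cs] csc by (simp add: len Q)
  have Kc: "?K \<in> carrier_mat (2 * n) (2 * ?m)" unfolding KQR using Qc Rc by simp
  have Ksym: "?K * Pi_mat ?m = Pi_mat n * conj_mat ?K"
  proof -
    have "set (map (\<lambda>c. ?Q *\<^sub>v c) cs) \<subseteq> carrier_vec (2 * n)" by (auto simp: Q)
    from paired_Pi_symmetric[OF this] show ?thesis unfolding Kp length_map cs(1) .
  qed
  have Qsym: "?Q * Pi_mat ?m = Pi_mat n * conj_mat ?Q"
    unfolding Q using paired_Pi_symmetric[OF vs] len by simp
  have Rker: "x = 0\<^sub>v (2 * ?m)" if "x \<in> carrier_vec (2 * ?m)" "R *\<^sub>v x = 0\<^sub>v (2 * ?m)" for x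
    using Pi_degree_kernel_trivial[OF cs that(1)] that(2) unfolding R_def by simp
  have Qker: "x = 0\<^sub>v (2 * ?m)" if x: "x \<in> carrier_vec (2 * ?m)" "?Q *\<^sub>v x = 0\<^sub>v (2 * n)" for x
  proof (rule Gamma_mats_kernel_trivial[OF Gamma(1) x(1)])
    have ad: "mat_adjoint ?Q \<in> carrier_mat (2 * ?m) (2 * n)"
      unfolding mat_adjoint_def using Qc by (intro carrier_matI) auto
    have G0: "Gamma0_mat n \<in> carrier_mat (2 * n) (2 * n)" by (simp add: Gamma0_mat_def mult_2)
    have zero: "M *\<^sub>v 0\<^sub>v b = 0\<^sub>v a" if "M \<in> carrier_mat a b" for M :: "complex mat" and a b
      using that by (intro eq_vecI) auto
    have "\<Gamma> *\<^sub>v x = (mat_adjoint ?Q * Gamma0_mat n) *\<^sub>v (?Q *\<^sub>v x)"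
      unfolding Gamma(2)[symmetric] by (rule assoc_mult_mat_vec[OF mult_carrier_mat[OF ad G0] Qc x(1)])
    also have "\<dots> = 0\<^sub>v (2 * ?m)"
      unfolding x(2) using zero[OF mult_carrier_mat[OF ad G0]] .
    finally show "\<Gamma> *\<^sub>v x = 0\<^sub>v (2 * ?m)" .
  qed
  have "vec_space.rank (2 * n) ?K = 2 * ?m"
  proof (rule vec_space.trivial_kernel_imp_full_rank[OF Kc])
    fix x assume x: "x \<in> carrier_vec (2 * ?m)" "?K *\<^sub>v x = 0\<^sub>v (2 * n)"
    have "?Q *\<^sub>v (R *\<^sub>v x) = 0\<^sub>v (2 * n)"
      using x(2) assoc_mult_mat_vec[OF Qc Rc x(1)] unfolding KQR by simp
    then have "R *\<^sub>v x = 0\<^sub>v (2 * ?m)" by (rule Qker[OF mult_mat_vec_carrier[OF Rc x(1)]])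
    then show "x = 0\<^sub>v (2 * ?m)" by (rule Rker[OF x(1)])
  qed
  moreover have "invertible_mat R" by (rule trivial_kernel_imp_invertible_mat[OF Rc Rker])
  moreover have "Gamma_QR n ?m ?K ?Q R"
    unfolding Gamma_QR_def using Kc Ksym Qc Qsym Gamma KQR
      Pi_upper_triangular_paired[OF cs] unfolding R_def by blast
  ultimately show ?thesis using Rc by auto
qed

end
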